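(* Let $S\subset\mathbb{R}^d$ be a (not necessarily bounded) measurable set of finite positive Lebesgue measure $|S|$, let $1\le p\le 2$ and let $q$ be the conjugate exponent to $p$. Then the probability measure $\mu=\frac{1}{|S|}\chi_S\,dx$ has an infinite discrete $(p,q)$-Bessel measure $\nu$.
   Context: For $t\in\mathbb{R}^d$ let $e_t(x)=e^{2\pi i t\cdot x}$. For a Borel probability measure $\mu$ on $\mathbb{R}^d$, $1\le p<\infty$, $f\in L^p(\mu)$ and $t\in\mathbb{R}^d$, put $\widehat{f d\mu}(t)=\int f(x)e^{-2\pi i t\cdot x}\,d\mu(x)$. The compatible semi-inner product $[f,g]_{L^p(\mu)}=\|g\|_{L^p(\mu)}^{2-p}\int f|g|^{p-1}\overline{\mathrm{sgn}(g)}\,d\mu$ satisfies $[f,e_t]_{L^p(\mu)}=\widehat{f d\mu}(t)$ for a probability measure $\mu$. For conjugate exponents $1<p,q<\infty$, a Borel measure $\nu$ on $\mathbb{R}^d$ is a $(p,q)$-Bessel measure for $\mu$ if there is $B>0$ with $\int_{\mathbb{R}^d}|[f,e_t]_{L^p(\mu)}|^q\,d\nu(t)\le B\|f\|_{L^p(\mu)}^q$ for all $f\in L^p(\mu)$. For $p=1$, $q=\infty$, the condition is $\|\widehat{f d\mu}\|_\infty\le B\|f\|_{L^1(\mu)}$ for all $f\in L^1(\mu)$, where $\|\cdot\|_\infty$ is the norm of $L^\infty(\nu)$. A discrete measure is one of the form $\sum_{\lambda\in\Lambda}c_\lambda\delta_\lambda$ with $\Lambda\subset\mathbb{R}^d$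 countable, $c_\lambda>0$ and $\delta_\lambda$ the Dirac measure at $\lambda$; it is infinite if its total mass is $\infty$. *)

theory Defs
  imports "HOL-Probability.Probability"
begin

definition exp_char :: "real ^ 'd \<Rightarrow> real ^ 'd \<Rightarrow> complex" where
  "exp_char t x = exp (2 * of_real pi * \<i> * of_real (t \<bullet> x))"

text \<open>Functions rather than almost-everywhere classes; all notions below respect equality
  almost everywhere.\<close>

definition Lp_space :: "real \<Rightarrow> 'a measure \<Rightarrow> ('a \<Rightarrow> complex) set" where
  "Lp_space p M = {f \<in> borel_measurable M. integrable M (\<lambda>x. norm (f x) powr p)}"

definition Lp_norm :: "real \<Rightarrow> 'a measure \<Rightarrow> ('a \<Rightarrow> complex) \<Rightarrow> real" where
  "Lp_norm p M f = (\<integral>x. norm (f x) powr p \<partial>M) powr (1 / p)"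

definition fourier :: "(real ^ 'd) measure \<Rightarrow> (real ^ 'd \<Rightarrow> complex) \<Rightarrow> real ^ 'd \<Rightarrow> complex" where
  "fourier \<mu> f t = (\<integral>x. f x * exp (- (2 * of_real pi * \<i> * of_real (t \<bullet> x))) \<partial>\<mu>)"

text \<open>For complex \<open>z\<close>, \<open>sgn z = z / \<bar>z\<bar>\<close> and \<open>sgn 0 = 0\<close>. The convention \<open>0 powr 0 = 0\<close>
  is therefore harmless in the case \<open>p = 1\<close>.\<close>

definition semi_inner ::
    "real \<Rightarrow> 'a measure \<Rightarrow> ('a \<Rightarrow> complex) \<Rightarrow> ('a \<Rightarrow> complex) \<Rightarrow> complex" where
  "semi_inner p M f g =
     of_real (Lp_norm p M g powr (2 - p)) *
     (\<integral>x. f x * of_real (norm (g x) powr (p - 1)) * cnj (sgn (g x)) \<partial>M)"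

text \<open>Meant for conjugate exponents \<open>p\<close> and \<open>q\<close>, so that the first branch is the case \<open>p = 1\<close>.
  Both sides of the inequalities are extended nonnegative reals: the left-hand side is a
  priori allowed to be infinite.\<close>

definition bessel_measure ::
    "real \<Rightarrow> ennreal \<Rightarrow> (real ^ 'd) measure \<Rightarrow> (real ^ 'd) measure \<Rightarrow> bool" where
  "bessel_measure p q \<mu> \<nu> \<longleftrightarrow>
     sets \<nu> = sets borel \<and>
     (\<exists>B::real. B > 0 \<and> (\<forall>f \<in> Lp_space p \<mu>.
        if q = \<infinity>
        then esssup \<nu> (\<lambda>t. ennreal (norm (fourier \<mu> f t))) \<le> ennreal (B * Lp_norm p \<mu> f)
        else (\<integral>\<^sup>+t. ennreal (norm (semi_inner p \<mu> f (exp_char t)) powr enn2real q) \<partial>\<nu>)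
               \<le> ennreal (B * Lp_norm p \<mu> f powr enn2real q)))"

definition discrete_measure :: "(real ^ 'd) measure \<Rightarrow> bool" where
  "discrete_measure \<nu> \<longleftrightarrow>
     sets \<nu> = sets borel \<and>
     (\<exists>(\<Lambda> :: (real ^ 'd) set) (c :: real ^ 'd \<Rightarrow> real).
        countable \<Lambda> \<and> (\<forall>l\<in>\<Lambda>. c l > 0) \<and>
        (\<forall>A \<in> sets borel.
           emeasure \<nu> A = (\<Sum>\<^sub>\<infinity>l\<in>\<Lambda>. ennreal (c l) * emeasure (return borel l) A)))"

text \<open>\<open>S\<close> may be any Lebesgue measurable set; the image under the identity restricts the
  normalized Lebesgue measure on \<open>S\<close> to the Borel sets.\<close>

definition normalized_lebesgue :: "(real ^ 'd) set \<Rightarrow> (real ^ 'd) measure" where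
  "normalized_lebesgue S =
     distr (density lebesgue (\<lambda>x. indicator S x / emeasure lebesgue S)) borel (\<lambda>x. x)"

end

theory Submission
  imports Defs
begin

text \<open>The measure \<open>\<nu>\<close> is the counting measure of a sequence of frequencies \<open>\<lambda>\<^sub>n\<close> so sparse that
  the exponentials \<open>e\<^sub>\<lambda>\<^sub>n\<close> are almost orthogonal in \<open>L\<^sup>2(\<mu>)\<close>. All that is used of \<open>\<mu>\<close> is that
  it is a probability measure that gives measure zero to the hyperplanes orthogonal to some
  vector \<open>u\<close>. Normalized Lebesgue measure on \<open>S\<close> has this property for every \<open>u \<noteq> 0\<close>.

  By an argument of Wiener, \<open>Wiener_lemma\<close>, the correlations of a given exponential with
  \<open>e\<^sub>k\<^sub>u\<close> tend to zero in mean square as \<open>k\<close> grows. Multiples \<open>\<lambda>\<^sub>n\<close> of \<open>u\<close> can therefore be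
  chosen successively with correlations that decay exponentially, so that the rows of the Gram
  matrix have bounded sums (\<open>exists_almost_orthogonal_sequence\<close>). By Schur's test this gives
  \<open>\<Sum>\<^sub>n \<bar>[f, e\<^sub>\<lambda>\<^sub>n]\<bar>\<^sup>2 \<le> 3 \<parallel>f\<parallel>\<^sup>2\<close> in \<open>L\<^sup>2(\<mu>)\<close>
  (\<open>Bessel_inequality_of_Gram_row_sums\<close>), which is the case \<open>p = 2\<close>.

  The case \<open>p = 1\<close> holds for every \<open>\<nu>\<close>, as a Fourier transform is bounded by the \<open>L\<^sup>1\<close>
  norm. For \<open>1 < p < 2\<close> the two endpoints are interpolated by a real-variable argument
  (\<open>Lq_bound_of_L2_bound\<close>). As the \<open>\<lambda>\<^sub>n\<close> are distinct and infinitely many, \<open>\<nu>\<close> is discrete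
  with infinite mass.\<close>

section \<open>Sparse exponentials are almost orthogonal\<close>

lemma borel_measurable_cnj [measurable]: "cnj \<in> borel_measurable borel"
  by (intro borel_measurable_continuous_onI continuous_intros)

lemma norm_integral_cnj_commute:
  fixes f g :: "'a \<Rightarrow> complex"
  shows "norm (\<integral>x. f x * cnj (g x) \<partial>M) = norm (\<integral>x. g x * cnj (f x) \<partial>M)"
proof -
  have "(\<integral>x. f x * cnj (g x) \<partial>M) = cnj (\<integral>x. g x * cnj (f x) \<partial>M)"
    by (subst Bochner_Integration.integral_cnj[symmetric]) (simp add: mult.commute)
  then show ?thesis by simp
qed

lemma norm_exp_char [simp]: "norm (exp_char t x) = 1"
  by (simp add: exp_char_def)

lemma exp_char_measurable [measurable]: "exp_char t \<in> borel_measurable borel"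
  unfolding exp_char_def by measurable

lemma exp_char_multiple: "exp_char (real k *\<^sub>R u) x = exp_char u x ^ k"
  by (simp add: exp_char_def mult_ac flip: exp_of_nat_mult)

lemma exp_char_eq_iff: "exp_char u x = exp_char u y \<longleftrightarrow> (\<exists>j::int. u \<bullet> x = u \<bullet> y + of_int j)"
proof -
  have "2 * of_real pi * \<i> * of_real (u \<bullet> x) = 2 * of_real pi * \<i> * of_real (u \<bullet> y) + of_int (2 * j) * pi * \<i>
        \<longleftrightarrow> u \<bullet> x = u \<bullet> y + of_int j" for j
  proof -
    have "2 * of_real pi * \<i> * of_real (u \<bullet> x) = 2 * of_real pi * \<i> * of_real (u \<bullet> y) + of_int (2 * j) * pi * \<i>
        \<longleftrightarrow> (2 * of_real pi * \<i>) * complex_of_real (u \<bullet> x) = (2 * of_real pi * \<i>) * complex_of_real (u \<bullet> y + of_int j)"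
      by (simp add: algebra_simps)
    also have "\<dots> \<longleftrightarrow> u \<bullet> x = u \<bullet> y + of_int j"
      unfolding mult_cancel_left of_real_eq_iff by simp
    finally show ?thesis .
  qed
  then show ?thesis unfolding exp_char_def exp_eq by simp
qed

lemma Cesaro_power_tendsto_0:
  fixes z :: complex
  assumes "norm z \<le> 1" "z \<noteq> 1"
  shows "(\<lambda>N. (\<Sum>k<N. z ^ k) / of_nat N) \<longlonglongrightarrow> 0"
proof (rule Lim_null_comparison)
  show "(\<lambda>N. 2 / norm (1 - z) * (1 / real N)) \<longlonglongrightarrow> 0"
    using tendsto_mult_right_zero[OF lim_1_over_n] by blast
  have "norm ((\<Sum>k<N. z ^ k) / of_nat N) \<le> 2 / norm (1 - z) * (1 / real N)" for N
  proof -
    have "norm (1 - z) * norm (\<Sum>k<N. z ^ k) = norm (1 - z ^ N)"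
      by (simp add: one_diff_power_eq norm_mult)
    also have "\<dots> \<le> 1 + norm (z ^ N)" by (metis norm_one norm_triangle_ineq4)
    also have "\<dots> \<le> 2" using assms by (simp add: norm_power power_le_one)
    finally have "norm (\<Sum>k<N. z ^ k) \<le> 2 / norm (1 - z)"
      using assms by (simp add: field_simps)
    then have "norm (\<Sum>k<N. z ^ k) / real N \<le> 2 / norm (1 - z) / real N"
      by (rule divide_right_mono) simp
    then show ?thesis by (simp add: norm_divide)
  qed
  then show "\<forall>\<^sub>F N in sequentially. norm ((\<Sum>k<N. z ^ k) / of_nat N) \<le> 2 / norm (1 - z) * (1 / real N)"
    by simp
qed

text \<open>A form of Wiener's lemma on the Fourier coefficients of continuous measures. The squares
  \<open>\<bar>c\<^sub>k\<bar>\<^sup>2\<close> are written as double integrals, so that their mean becomes the integral of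
  \<open>f x cnj (f y)\<close> times the mean of the powers \<open>z\<^sup>k\<close> with \<open>z = exp (2\<pi>i u \<bullet> (y - x))\<close>.
  This tends to \<open>0\<close> unless \<open>z = 1\<close>, and for fixed \<open>y\<close> the points \<open>x\<close> with \<open>z = 1\<close> lie on
  countably many hyperplanes orthogonal to \<open>u\<close>.\<close>

lemma Wiener_lemma:
  fixes f :: "real ^ 'd \<Rightarrow> complex" and M :: "(real ^ 'd) measure"
  assumes "prob_space M" and M [measurable_cong]: "sets M = sets borel"
    and hyperplane: "\<And>a. AE x in M. u \<bullet> x \<noteq> a"
    and f [measurable]: "f \<in> borel_measurable M" and f1: "\<And>x. norm (f x) \<le> 1"
  shows "(\<lambda>N. (\<Sum>k<N. (norm (\<integral>x. f x * cnj (exp_char (real k *\<^sub>R u) x) \<partial>M))\<^sup>2) / real N) \<longlonglongrightarrow> 0"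
proof -
  interpret prob_space M by fact
  define E where "E = exp_char u"
  define c where "c k = (\<integral>x. f x * cnj (E x ^ k) \<partial>M)" for k
  define h where "h N y = (\<Sum>k<N. c k * E y ^ k) / of_nat N" for N y
  have E1: "norm (E x) = 1" for x by (simp add: E_def)
  have [measurable]: "E \<in> borel_measurable M" unfolding E_def by measurable
  have [measurable]: "h N \<in> borel_measurable M" for N unfolding h_def by measurable
  have int: "integrable M (\<lambda>x. f x * cnj (E x ^ k))" for k
    by (rule integrable_const_bound[of _ 1]) (auto simp: norm_mult norm_power E1 f1)
  have c1: "norm (c k) \<le> 1" for k
    unfolding c_def
    using Bochner_Integration.integral_norm_bound_integral[OF int, of "\<lambda>_. 1" k]
    by (simp add: norm_mult norm_power E1 f1 prob_space)
  have h1: "norm (h N y) \<le> 1" for N y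
  proof -
    have "norm (\<Sum>k<N. c k * E y ^ k) \<le> (\<Sum>k<N. 1)"
      by (rule sum_norm_le) (simp add: norm_mult norm_power E1 c1)
    then show ?thesis by (cases "N = 0") (simp_all add: h_def norm_divide)
  qed
  have h_eq: "h N y = (\<integral>x. f x * ((\<Sum>k<N. (E y * cnj (E x)) ^ k) / of_nat N) \<partial>M)" for N y
  proof -
    have "h N y = (\<Sum>k<N. (E y ^ k / of_nat N) * c k)"
      by (simp add: h_def sum_divide_distrib mult_ac)
    also have "\<dots> = (\<Sum>k<N. \<integral>x. (E y ^ k / of_nat N) * (f x * cnj (E x ^ k)) \<partial>M)"
      unfolding c_def by (simp only: integral_mult_right_zero)
    also have "\<dots> = (\<integral>x. (\<Sum>k<N. (E y ^ k / of_nat N) * (f x * cnj (E x ^ k))) \<partial>M)"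
      by (rule Bochner_Integration.integral_sum[symmetric]) (intro integrable_mult_right int)
    also have "\<dots> = (\<integral>x. f x * ((\<Sum>k<N. (E y * cnj (E x)) ^ k) / of_nat N) \<partial>M)"
      by (simp add: sum_divide_distrib sum_distrib_left power_mult_distrib mult_ac)
    finally show ?thesis .
  qed
  \<comment> \<open>The limit is \<open>0\<close> away from the countably many hyperplanes on which \<open>E x = E y\<close>.\<close>
  have h_lim: "(\<lambda>N. h N y) \<longlonglongrightarrow> 0" for y
  proof -
    have "AE x in M. \<forall>j::int. u \<bullet> x \<noteq> u \<bullet> y + of_int j"
      using hyperplane by (subst AE_all_countable) auto
    then have "AE x in M. (\<lambda>N. f x * ((\<Sum>k<N. (E y * cnj (E x)) ^ k) / of_nat N)) \<longlonglongrightarrow> 0"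
    proof eventually_elim
      case (elim x)
      then have "E x \<noteq> E y" unfolding E_def exp_char_eq_iff by auto
      moreover have "E x * cnj (E x) = 1" by (simp add: E1 flip: complex_norm_square)
      ultimately have "E y * cnj (E x) \<noteq> 1"
        by (metis mult_cancel_right zero_neq_one mult_zero_right)
      then show ?case
        by (intro tendsto_mult_right_zero Cesaro_power_tendsto_0) (auto simp: norm_mult E1)
    qed
    moreover have "norm (f x * ((\<Sum>k<N. (E y * cnj (E x)) ^ k) / of_nat N)) \<le> 1" for N x
    proof -
      have "norm (\<Sum>k<N. (E y * cnj (E x)) ^ k) \<le> (\<Sum>k<N. 1)"
        by (rule sum_norm_le) (simp add: norm_mult norm_power E1)
      then have "norm ((\<Sum>k<N. (E y * cnj (E x)) ^ k) / of_nat N) \<le> 1"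
        by (cases "N = 0") (simp_all add: norm_divide)
      then show ?thesis unfolding norm_mult using f1 by (intro mult_le_one) auto
    qed
    ultimately have "(\<lambda>N. \<integral>x. f x * ((\<Sum>k<N. (E y * cnj (E x)) ^ k) / of_nat N) \<partial>M) \<longlonglongrightarrow> (\<integral>x. 0 \<partial>M)"
      by (intro integral_dominated_convergence[where w = "\<lambda>_. 1"]) auto
    then show ?thesis by (simp add: h_eq)
  qed
  have lim: "(\<lambda>N. \<integral>y. cnj (f y) * h N y \<partial>M) \<longlonglongrightarrow> (\<integral>y. 0 \<partial>M)"
    by (intro integral_dominated_convergence[where w = "\<lambda>_. 1"])
       (auto simp: norm_mult intro!: tendsto_mult_right_zero h_lim mult_le_one f1 h1)
  have "(\<integral>y. cnj (f y) * h N y \<partial>M) = of_real ((\<Sum>k<N. (norm (c k))\<^sup>2) / real N)" for N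
  proof -
    have "(\<integral>y. cnj (f y) * h N y \<partial>M) = (\<integral>y. (\<Sum>k<N. (c k / of_nat N) * cnj (f y * cnj (E y ^ k))) \<partial>M)"
      by (simp add: h_def sum_divide_distrib sum_distrib_left mult_ac)
    also have "\<dots> = (\<Sum>k<N. \<integral>y. (c k / of_nat N) * cnj (f y * cnj (E y ^ k)) \<partial>M)"
      by (rule Bochner_Integration.integral_sum) (intro integrable_mult_right integrable_cnj int)
    also have "\<dots> = (\<Sum>k<N. (c k / of_nat N) * cnj (c k))"
      by (simp only: integral_mult_right_zero Bochner_Integration.integral_cnj c_def[symmetric])
    also have "\<dots> = of_real ((\<Sum>k<N. (norm (c k))\<^sup>2) / real N)"
      by (simp add: sum_divide_distrib complex_norm_square del: of_real_power)
    finally show ?thesis .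
  qed
  with lim have "(\<lambda>N. complex_of_real ((\<Sum>k<N. (norm (c k))\<^sup>2) / real N)) \<longlonglongrightarrow> of_real 0"
    by simp
  then show ?thesis
    unfolding tendsto_of_real_iff by (simp add: c_def E_def exp_char_multiple)
qed

text \<open>The mean value in \<open>Wiener_lemma\<close> for the bounded functions \<open>exp_char t\<close>, added up over the
  finitely many \<open>t\<close>, becomes small, and so does one of its terms.\<close>

lemma exists_almost_orthogonal_frequency:
  fixes u :: "real ^ 'd" and M :: "(real ^ 'd) measure"
  assumes "prob_space M" and M [measurable_cong]: "sets M = sets borel"
    and hyperplane: "\<And>a. AE x in M. u \<bullet> x \<noteq> a"
    and F: "finite F" and \<epsilon>: "\<epsilon> > 0"
  shows "\<exists>k. \<forall>t\<in>F. norm (\<integral>x. exp_char t x * cnj (exp_char (real k *\<^sub>R u) x) \<partial>M) < \<epsilon>"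
proof -
  interpret prob_space M by fact
  define G where "G t k = norm (\<integral>x. exp_char t x * cnj (exp_char (real k *\<^sub>R u) x) \<partial>M)" for t k
  have "(\<lambda>N. \<Sum>t\<in>F. (\<Sum>k<N. (G t k)\<^sup>2) / real N) \<longlonglongrightarrow> (\<Sum>t\<in>F. 0)"
    unfolding G_def by (intro tendsto_sum Wiener_lemma assms(1) M hyperplane) auto
  then have "\<forall>\<^sub>F N in sequentially. (\<Sum>t\<in>F. (\<Sum>k<N. (G t k)\<^sup>2) / real N) < \<epsilon>\<^sup>2"
    using \<epsilon> by (intro order_tendstoD(2)) auto
  then obtain N where N: "N > 0" "(\<Sum>t\<in>F. (\<Sum>k<N. (G t k)\<^sup>2) / real N) < \<epsilon>\<^sup>2"
    using eventually_conj[OF eventually_gt_at_top[of "0::nat"]] by (metis (no_types, lifting) eventually_sequentially le_refl)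
  \<comment> \<open>A term of a finite sequence lies below any strict upper bound of its mean.\<close>
  have "\<exists>k<N. (\<Sum>t\<in>F. (G t k)\<^sup>2) < \<epsilon>\<^sup>2"
  proof (rule ccontr)
    assume "\<not> ?thesis"
    then have "(\<Sum>k<N. \<epsilon>\<^sup>2) \<le> (\<Sum>k<N. \<Sum>t\<in>F. (G t k)\<^sup>2)"
      by (intro sum_mono) (meson lessThan_iff not_less)
    also have "\<dots> = (\<Sum>t\<in>F. \<Sum>k<N. (G t k)\<^sup>2)" by (rule sum.swap)
    finally show False using N by (simp add: field_simps flip: sum_divide_distrib)
  qed
  then obtain k where k: "(\<Sum>t\<in>F. (G t k)\<^sup>2) < \<epsilon>\<^sup>2" by auto
  have "G t k < \<epsilon>" if "t \<in> F" for t
  proof -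
    have "(G t k)\<^sup>2 \<le> (\<Sum>t\<in>F. (G t k)\<^sup>2)" using F that by (intro member_le_sum) auto
    with k have "(G t k)\<^sup>2 < \<epsilon>\<^sup>2" by linarith
    then show ?thesis by (rule power_less_imp_less_base) (use \<epsilon> in simp)
  qed
  then show ?thesis unfolding G_def by blast
qed

text \<open>Frequencies are chosen one after the other among the multiples of \<open>u\<close>, the \<open>n\<close>-th one with
  correlations below \<open>4\<^sup>-\<^sup>n\<close> with all earlier ones. Since \<open>4\<^sup>-\<^sup>n \<le> 2\<^sup>-\<^sup>m\<close> for \<open>m < n\<close>, a
  row sum is at most \<open>1\<close> from the diagonal plus \<open>\<Sum> 2\<^sup>-\<^sup>m = 2\<close>.\<close>

lemma exists_almost_orthogonal_sequence:
  fixes u :: "real ^ 'd" and M :: "(real ^ 'd) measure"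
  assumes "prob_space M" and M [measurable_cong]: "sets M = sets borel"
    and hyperplane: "\<And>a. AE x in M. u \<bullet> x \<noteq> a"
  obtains l :: "nat \<Rightarrow> real ^ 'd" where "inj l"
    and "\<And>N n. (\<Sum>m<N. norm (\<integral>x. exp_char (l m) x * cnj (exp_char (l n) x) \<partial>M)) \<le> 3"
proof -
  interpret prob_space M by fact
  define G where "G s t = norm (\<integral>x. exp_char s x * cnj (exp_char t x) \<partial>M)" for s t :: "real ^ 'd"
  have "\<exists>k::nat \<Rightarrow> nat. \<forall>n. \<forall>m<n. G (real (k m) *\<^sub>R u) (real (k n) *\<^sub>R u) < (1/4) ^ n"
  proof (rule dependent_wellorder_choice)
    fix n and k :: "nat \<Rightarrow> nat"
    show "\<exists>r. \<forall>m<n. G (real (k m) *\<^sub>R u) (real r *\<^sub>R u) < (1/4) ^ n"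
      using exists_almost_orthogonal_frequency[OF assms(1) M hyperplane, of "(\<lambda>m. real (k m) *\<^sub>R u) ` {..<n}" "(1/4) ^ n"]
      by (auto simp: G_def)
  qed simp
  then obtain k :: "nat \<Rightarrow> nat" where k: "\<And>m n. m < n \<Longrightarrow> G (real (k m) *\<^sub>R u) (real (k n) *\<^sub>R u) < (1/4) ^ n"
    by blast
  define l where "l n = real (k n) *\<^sub>R u" for n
  have G_sym: "G s t = G t s" for s t
    unfolding G_def by (rule norm_integral_cnj_commute)
  have G_diag: "G t t = 1" for t
    by (simp add: G_def prob_space flip: complex_norm_square)
  \<comment> \<open>A repeated frequency would give the correlation \<open>1\<close>.\<close>
  have "l m \<noteq> l n" if "m < n" for m n
  proof
    assume "l m = l n"
    then have "1 < (1/4::real) ^ n" using k[OF that] G_diag[of "l n"] by (simp only: l_def)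
    then show False using power_le_one[of "1/4::real" n] by linarith
  qed
  then have "inj l" by (metis injI linorder_neqE_nat)
  moreover have "(\<Sum>m<N. G (l m) (l n)) \<le> 3" for N n
  proof -
    \<comment> \<open>On both sides of the diagonal, row \<open>n\<close> is dominated by the summable sequence \<open>2\<^sup>-\<^sup>m\<close>.\<close>
    have G_le: "G (l m) (l n) \<le> (1/2) ^ m" if "m < n" for m n
    proof -
      have "G (l m) (l n) \<le> (1/4) ^ n" using k[OF that] by (simp add: l_def)
      also have "\<dots> \<le> (1/2) ^ n" by (rule power_mono) auto
      also have "\<dots> \<le> (1/2) ^ m" using that by (intro power_decreasing) auto
      finally show ?thesis .
    qed
    have G_ge: "G (l m) (l n) \<le> (1/2) ^ m" if "n < m" for m n
    proof -
      have "G (l m) (l n) \<le> (1/4) ^ m" using k[OF that] by (simp add: l_def G_sym)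
      also have "\<dots> \<le> (1/2) ^ m" by (rule power_mono) auto
      finally show ?thesis .
    qed
    have "(\<Sum>m<N. G (l m) (l n)) \<le> (\<Sum>m<N. (if m = n then 1 else 0) + (1/2) ^ m)"
      using G_le[of _ n] G_ge[of n]
      by (intro sum_mono) (smt (verit) G_diag linorder_neqE_nat zero_le_power divide_nonneg_nonneg)
    also have "\<dots> = (\<Sum>m<N. if m = n then 1 else 0) + (\<Sum>m<N. (1/2) ^ m)"
      by (rule sum.distrib)
    also have "(\<Sum>m<N. if m = n then 1 else 0) \<le> (1::real)" by simp
    also have "(\<Sum>m<N. (1/2) ^ m) \<le> (2::real)"
      by (subst geometric_sum) auto
    finally show ?thesis by simp
  qed
  ultimately show thesis using that unfolding G_def by blast
qed

section \<open>Bessel inequality for almost orthogonal functions\<close>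

lemma integrable_of_Lp_space:
  assumes "finite_measure M" "1 \<le> p" and f: "f \<in> Lp_space p M"
  shows "integrable M f"
proof (rule Bochner_Integration.integrable_bound)
  interpret finite_measure M by fact
  show "integrable M (\<lambda>x. 1 + norm (f x) powr p)"
    using f by (simp add: Lp_space_def)
  have "norm (f x) \<le> 1 + norm (f x) powr p" for x
  proof (cases "norm (f x) \<le> 1")
    case False
    then have "norm (f x) powr 1 \<le> norm (f x) powr p"
      using assms by (intro powr_mono) auto
    then show ?thesis using False by simp
  qed (simp add: add_increasing2)
  then show "AE x in M. norm (f x) \<le> norm (1 + norm (f x) powr p)"
    by (intro AE_I2) (simp add: abs_of_nonneg)
qed (use f in \<open>simp add: Lp_space_def\<close>)

text \<open>By Schur's test, the Gram matrix of the \<open>e\<^sub>n\<close> acts on \<open>\<ell>\<^sup>2\<close> with norm at most \<open>K\<close>; hence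
  \<open>\<parallel>\<Sum> c\<^sub>n e\<^sub>n\<parallel>\<^sup>2 \<le> K \<Sum> \<bar>c\<^sub>n\<bar>\<^sup>2\<close>. With \<open>c\<^sub>n\<close> the coefficients of \<open>g\<close>, the square of
  \<open>g - (\<Sum> c\<^sub>n e\<^sub>n) / K\<close> is expanded as in the classical proof of Bessel's inequality.
  Writing the norm of \<open>g\<close> as an extended integral covers all measurable \<open>g\<close>, which spares
  later applications from checking square integrability.\<close>

lemma Bessel_inequality_of_Gram_row_sums:
  fixes e :: "nat \<Rightarrow> 'a \<Rightarrow> complex"
  assumes "finite_measure M" and e [measurable]: "\<And>n. e n \<in> borel_measurable M"
    and e1: "\<And>n x. norm (e n x) \<le> 1" and K: "K > 0"
    and row: "\<And>N n. (\<Sum>m<N. norm (\<integral>x. e m x * cnj (e n x) \<partial>M)) \<le> K"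
    and g [measurable]: "g \<in> borel_measurable M"
  shows "(\<Sum>n. ennreal ((norm (\<integral>x. g x * cnj (e n x) \<partial>M))\<^sup>2))
           \<le> ennreal K * (\<integral>\<^sup>+x. ennreal ((norm (g x))\<^sup>2) \<partial>M)"
proof (cases "(\<integral>\<^sup>+x. ennreal ((norm (g x))\<^sup>2) \<partial>M) = \<infinity>")
  case True
  then show ?thesis using K by (simp add: ennreal_mult_top)
next
  case False
  interpret finite_measure M by fact
  have g2: "integrable M (\<lambda>x. (norm (g x))\<^sup>2)"
    using False by (intro integrableI_nonneg) (auto simp: top.not_eq_extremum)
  have g1: "integrable M g"
    by (rule integrable_of_Lp_space[of M 2]) (use g2 finite_measure_axioms in \<open>auto simp: Lp_space_def\<close>)
  have ie: "integrable M (\<lambda>x. g x * cnj (e n x))" for n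
    by (rule Bochner_Integration.integrable_bound[OF g1])
       (auto simp: norm_mult intro!: AE_I2 mult_left_le e1)
  have iee: "integrable M (\<lambda>x. e m x * cnj (e n x))" for m n
    by (rule integrable_const_bound[of _ 1])
       (auto simp: norm_mult intro!: AE_I2 mult_le_one e1)
  define c where "c n = (\<integral>x. g x * cnj (e n x) \<partial>M)" for n
  define G where "G m n = (\<integral>x. e m x * cnj (e n x) \<partial>M)" for m n
  have G_sym: "norm (G m n) = norm (G n m)" for m n
    unfolding G_def by (rule norm_integral_cnj_commute)
  have finite_sum: "(\<Sum>n<N. (norm (c n))\<^sup>2) \<le> K * (\<integral>x. (norm (g x))\<^sup>2 \<partial>M)" for N
  proof -
    define C where "C = (\<Sum>n<N. (norm (c n))\<^sup>2)"
    define h where "h x = (\<Sum>n<N. c n * e n x)" for x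
    have h [measurable]: "h \<in> borel_measurable M" unfolding h_def by measurable
    have gh: "(\<lambda>x. g x * cnj (h x)) = (\<lambda>x. \<Sum>n<N. cnj (c n) * (g x * cnj (e n x)))"
      by (simp add: fun_eq_iff h_def sum_distrib_left mult_ac)
    have int_gh: "integrable M (\<lambda>x. g x * cnj (h x))"
      unfolding gh by (intro Bochner_Integration.integrable_sum integrable_mult_right ie)
    have "(\<integral>x. g x * cnj (h x) \<partial>M) = (\<Sum>n<N. cnj (c n) * c n)"
      unfolding gh
      by (subst Bochner_Integration.integral_sum) (auto simp: c_def ie)
    also have "\<dots> = of_real C"
      by (simp add: C_def complex_norm_square mult.commute del: of_real_power)
    finally have val_gh: "(\<integral>x. g x * cnj (h x) \<partial>M) = of_real C" .
    have hh: "(\<lambda>x. h x * cnj (h x)) = (\<lambda>x. \<Sum>m<N. \<Sum>n<N. (c m * cnj (c n)) * (e m x * cnj (e n x)))"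
      by (simp add: fun_eq_iff h_def sum_product mult_ac)
    have int_hh: "integrable M (\<lambda>x. h x * cnj (h x))"
      unfolding hh by (intro Bochner_Integration.integrable_sum integrable_mult_right iee)
    have val_hh: "(\<integral>x. h x * cnj (h x) \<partial>M) = (\<Sum>m<N. \<Sum>n<N. (c m * cnj (c n)) * G m n)"
      unfolding hh
      by (subst Bochner_Integration.integral_sum
          | intro Bochner_Integration.integrable_sum integrable_mult_right iee)+
         (simp add: G_def)
    have int_h2: "integrable M (\<lambda>x. (norm (h x))\<^sup>2)"
      using integrable_Re[OF int_hh] by (simp del: of_real_power flip: complex_norm_square)
    have "(\<integral>x. (norm (h x))\<^sup>2 \<partial>M) = Re (\<integral>x. h x * cnj (h x) \<partial>M)"
      by (subst integral_Re[OF int_hh, symmetric]) (simp del: of_real_power flip: complex_norm_square)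
    also have "\<dots> \<le> (\<Sum>m<N. \<Sum>n<N. norm (c m) * norm (c n) * norm (G m n))"
      unfolding val_hh
      by (rule order_trans[OF complex_Re_le_cmod])
         (auto intro!: sum_norm_le simp: norm_mult)
    \<comment> \<open>Schur's test: the symmetric kernel \<open>\<bar>G m n\<bar>\<close> is split by the arithmetic-geometric mean.\<close>
    also have "\<dots> \<le> (\<Sum>m<N. \<Sum>n<N. ((norm (c m))\<^sup>2 * norm (G n m) + (norm (c n))\<^sup>2 * norm (G m n)) / 2)"
    proof (intro sum_mono)
      fix m n
      have "norm (c m) * norm (c n) \<le> ((norm (c m))\<^sup>2 + (norm (c n))\<^sup>2) / 2"
        using sum_squares_bound[of "norm (c m)" "norm (c n)"] by simp
      then have "norm (c m) * norm (c n) * norm (G m n)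
            \<le> ((norm (c m))\<^sup>2 + (norm (c n))\<^sup>2) / 2 * norm (G m n)"
        by (rule mult_right_mono) simp
      then show "norm (c m) * norm (c n) * norm (G m n)
            \<le> ((norm (c m))\<^sup>2 * norm (G n m) + (norm (c n))\<^sup>2 * norm (G m n)) / 2"
        by (simp add: G_sym[of n m] field_simps)
    qed
    also have "\<dots> = ((\<Sum>m<N. (norm (c m))\<^sup>2 * (\<Sum>n<N. norm (G n m)))
                    + (\<Sum>n<N. (norm (c n))\<^sup>2 * (\<Sum>m<N. norm (G m n)))) / 2"
      unfolding sum_divide_distrib[symmetric] sum.distrib sum_distrib_left
      by (subst (3) sum.swap) simp
    also have "\<dots> \<le> K * C"
    proof -
      have "(\<Sum>m<N. (norm (c m))\<^sup>2 * (\<Sum>n<N. norm (G n m))) \<le> (\<Sum>m<N. (norm (c m))\<^sup>2 * K)"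
        using row by (intro sum_mono mult_left_mono) (auto simp: G_def)
      moreover have "(\<Sum>m<N. (norm (c m))\<^sup>2 * K) = K * C"
        by (simp add: C_def sum_distrib_left mult.commute)
      ultimately show ?thesis by simp
    qed
    finally have h2: "(\<integral>x. (norm (h x))\<^sup>2 \<partial>M) \<le> K * C" .
    define r where "r x = Re (g x * cnj (h x))" for x
    have int_r: "integrable M r" unfolding r_def by (rule integrable_Re[OF int_gh])
    have val_r: "(\<integral>x. r x \<partial>M) = C" unfolding r_def integral_Re[OF int_gh] val_gh by simp
    have expand: "(norm (g x - h x / of_real K))\<^sup>2
        = (norm (g x))\<^sup>2 - 2 / K * r x + (norm (h x))\<^sup>2 / K\<^sup>2" for x
      using K unfolding cmod_power2 r_def by (simp add: field_simps power2_eq_square)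
    \<comment> \<open>With \<open>h = \<Sum> c\<^sub>n e\<^sub>n\<close>, the vector \<open>h / K\<close> is the multiple of \<open>h\<close> for which
      \<open>\<parallel>g - \<alpha> h\<parallel>\<^sup>2 \<le> \<parallel>g\<parallel>\<^sup>2 - 2 \<alpha> C + \<alpha>\<^sup>2 K C\<close> is smallest.\<close>
    have "0 \<le> (\<integral>x. (norm (g x - h x / of_real K))\<^sup>2 \<partial>M)" by simp
    also have "\<dots> = (\<integral>x. (norm (g x))\<^sup>2 \<partial>M) - 2 / K * C + (\<integral>x. (norm (h x))\<^sup>2 \<partial>M) / K\<^sup>2"
      unfolding expand using g2 int_h2 int_r val_r by simp
    also have "\<dots> \<le> (\<integral>x. (norm (g x))\<^sup>2 \<partial>M) - 2 / K * C + K * C / K\<^sup>2"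
      using h2 by (simp add: divide_right_mono)
    also have "\<dots> = (\<integral>x. (norm (g x))\<^sup>2 \<partial>M) - C / K"
      using K by (simp add: field_simps power2_eq_square)
    finally show ?thesis using K by (simp add: C_def field_simps)
  qed
  have "(\<Sum>n. ennreal ((norm (c n))\<^sup>2)) \<le> ennreal (K * (\<integral>x. (norm (g x))\<^sup>2 \<partial>M))"
    by (intro suminf_le_const) (auto simp: sum_ennreal intro!: ennreal_leI finite_sum)
  also have "\<dots> = ennreal K * (\<integral>\<^sup>+x. ennreal ((norm (g x))\<^sup>2) \<partial>M)"
    using K by (subst nn_integral_eq_integral[OF g2]) (auto simp: ennreal_mult)
  finally show ?thesis by (simp add: c_def)
qed

section \<open>Interpolation\<close>

lemma nn_integral_powr_from_0:
  assumes "a > -1" "c \<ge> 0"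
  shows "(\<integral>\<^sup>+s. ennreal ((a + 1) * s powr a) * indicator {0..c} s \<partial>lborel) = ennreal (c powr (a + 1))"
proof -
  have "((\<lambda>s. (a + 1) * s powr a) has_integral (a + 1) * (c powr (a + 1) / (a + 1))) {0..c}"
    by (intro has_integral_mult_right has_integral_powr_from_0 assms)
  then show ?thesis
    using assms by (subst nn_integral_has_integral_lebesgue') auto
qed

text \<open>Marcinkiewicz interpolation between the trivial bound \<open>L\<^sup>1 \<rightarrow> \<ell>\<^sup>\<infinity>\<close> and the bound
  \<open>L\<^sup>2 \<rightarrow> \<ell>\<^sup>2\<close>. Let \<open>t\<^sub>n\<close> be the moduli of the coefficients of \<open>f\<close> and \<open>A = \<integral>\<bar>f\<bar>\<^sup>p\<close>.
  By the layer cake formula \<open>t\<^sub>n\<^sup>q\<close> is the integral of \<open>(q - 2) s\<^sup>q\<^sup>-\<^sup>3 t\<^sub>n\<^sup>2\<close> over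
  \<open>0 < s \<le> t\<^sub>n\<close>. At each height \<open>s\<close>, the function \<open>f\<close> is cut where
  \<open>2 A \<bar>f\<bar>\<^sup>1\<^sup>-\<^sup>p = s\<close>: the large part contributes at most \<open>s / 2\<close> to every coefficient, so
  the coefficients with \<open>t\<^sub>n \<ge> s\<close> are controlled by the small part and the \<open>L\<^sup>2\<close> bound.
  Integrating over \<open>s\<close> first turns the resulting double integral into a multiple of
  \<open>\<integral>\<bar>f\<bar>\<^sup>p\<close>.\<close>

lemma Lq_bound_of_L2_bound:
  fixes e :: "nat \<Rightarrow> 'a \<Rightarrow> complex"
  assumes "finite_measure M" and e [measurable]: "\<And>n. e n \<in> borel_measurable M"
    and e1: "\<And>n x. norm (e n x) \<le> 1" and K: "K > 0"
    and L2: "\<And>g. g \<in> borel_measurable M \<Longrightarrow>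
      (\<Sum>n. ennreal ((norm (\<integral>x. g x * cnj (e n x) \<partial>M))\<^sup>2))
           \<le> ennreal K * (\<integral>\<^sup>+x. ennreal ((norm (g x))\<^sup>2) \<partial>M)"
    and p: "1 < p" "p < 2" and q: "q = p / (p - 1)"
    and f [measurable]: "f \<in> borel_measurable M"
    and f1: "integrable M f" and fp: "integrable M (\<lambda>x. norm (f x) powr p)"
  shows "(\<Sum>n. ennreal (norm (\<integral>x. f x * cnj (e n x) \<partial>M) powr q))
           \<le> ennreal (2 powr q * K * (\<integral>x. norm (f x) powr p \<partial>M) powr (q - 1))"
proof -
  interpret finite_measure M by fact
  interpret pair_sigma_finite M lborel
    by (simp add: pair_sigma_finite_def lborel.sigma_finite_measure_axioms sigma_finite_measure_axioms)
  define A where "A = (\<integral>x. norm (f x) powr p \<partial>M)"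
  define t where "t n = norm (\<integral>x. f x * cnj (e n x) \<partial>M)" for n
  define W where "W s = ennreal ((q - 2) * s powr (q - 3))" for s
  define \<beta> where "\<beta> x = 2 * A * norm (f x) powr (1 - p)" for x
  have [measurable]: "W \<in> borel_measurable borel" "\<beta> \<in> borel_measurable M"
    unfolding W_def \<beta>_def by measurable
  have [measurable]: "Measurable.pred M (\<lambda>x. s \<in> {0..\<beta> x})" for s
    unfolding atLeastAtMost_iff by measurable
  have [measurable]: "Measurable.pred (M \<Otimes>\<^sub>M lborel) (\<lambda>z. snd z \<in> {0..\<beta> (fst z)})"
    "Measurable.pred (lborel \<Otimes>\<^sub>M M) (\<lambda>z. fst z \<in> {0..\<beta> (snd z)})"
    unfolding atLeastAtMost_iff by measurable
  have q2: "q > 2" using p by (simp add: q field_simps)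
  have A0: "A \<ge> 0" by (simp add: A_def)
  have \<beta>0: "\<beta> x \<ge> 0" for x using A0 by (simp add: \<beta>_def)
  have W: "(\<integral>\<^sup>+s. W s * indicator {0..c} s \<partial>lborel) = ennreal (c powr (q - 2))" if "c \<ge> 0" for c
    using nn_integral_powr_from_0[of "q - 3" c] that q2 by (simp add: W_def)
  have ie: "integrable M (\<lambda>x. g x * cnj (e n x))" if "integrable M g" for n and g :: "'a \<Rightarrow> complex"
    by (rule Bochner_Integration.integrable_bound[OF that])
       (use borel_measurable_integrable[OF that] in \<open>auto simp: norm_mult intro!: AE_I2 mult_left_le e1\<close>)
  show ?thesis
  proof (cases "A = 0")
    case True
    then have "AE x in M. norm (f x) powr p = 0"
      using integral_nonneg_eq_0_iff_AE[OF fp] by (simp add: A_def)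
    then have "t n = 0" for n
      unfolding t_def by (subst integral_eq_zero_AE) auto
    then show ?thesis using q2 by (simp add: t_def)
  next
    case False
    then have A: "A > 0" using A0 by simp
    \<comment> \<open>Where \<open>\<beta> < s\<close>, that is where \<open>\<bar>f\<bar>\<close> is large, \<open>\<bar>f\<bar> = \<bar>f\<bar>\<^sup>p \<bar>f\<bar>\<^sup>1\<^sup>-\<^sup>p \<le> s / (2 A) \<bar>f\<bar>\<^sup>p\<close>.
      So that part has \<open>L\<^sup>1\<close> norm at most \<open>s / 2\<close>.\<close>
    have truncate: "t n \<le> s / 2 + norm (\<integral>x. (f x * indicator {0..\<beta> x} s) * cnj (e n x) \<partial>M)"
      if s: "s > 0" for n s
    proof -
      define f1 where "f1 x = f x * indicator {0..\<beta> x} s" for x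
      define f2 where "f2 x = f x - f1 x" for x
      have [measurable]: "f1 \<in> borel_measurable M" "f2 \<in> borel_measurable M"
        unfolding f1_def f2_def by measurable
      have i1: "integrable M f1"
        by (rule Bochner_Integration.integrable_bound[OF \<open>integrable M f\<close>])
           (auto simp: f1_def indicator_def intro!: AE_I2)
      have i2: "integrable M f2"
        unfolding f2_def by (intro Bochner_Integration.integrable_diff i1 \<open>integrable M f\<close>)
      have b2: "norm (f2 x) \<le> s / (2 * A) * norm (f x) powr p" for x
      proof (cases "f x = 0 \<or> s \<le> \<beta> x")
        case True
        then show ?thesis using s A by (auto simp: f2_def f1_def)
      next
        case False
        then have "norm (f2 x) = norm (f x) powr (1 - p) * norm (f x) powr p"
          by (simp add: f2_def f1_def flip: powr_add)
        also have "\<dots> \<le> s / (2 * A) * norm (f x) powr p"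
          using False A by (intro mult_right_mono) (auto simp: \<beta>_def field_simps)
        finally show ?thesis .
      qed
      have "t n = norm ((\<integral>x. f2 x * cnj (e n x) \<partial>M) + (\<integral>x. f1 x * cnj (e n x) \<partial>M))"
        unfolding t_def
        by (subst Bochner_Integration.integral_add[symmetric])
           (use ie[OF i1] ie[OF i2] in \<open>auto simp: f2_def algebra_simps\<close>)
      also have "\<dots> \<le> norm (\<integral>x. f2 x * cnj (e n x) \<partial>M) + norm (\<integral>x. f1 x * cnj (e n x) \<partial>M)"
        by (rule norm_triangle_ineq)
      also have "norm (\<integral>x. f2 x * cnj (e n x) \<partial>M) \<le> (\<integral>x. s / (2 * A) * norm (f x) powr p \<partial>M)"
        by (intro order_trans[OF integral_norm_bound] integral_mono')
           (use fp b2 s A in \<open>auto simp: norm_mult intro: order_trans[OF mult_left_le[OF e1 norm_ge_zero]]\<close>)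
      also have "\<dots> = s / 2" using A by (simp add: A_def[symmetric])
      finally show ?thesis by (simp add: f1_def)
    qed
    \<comment> \<open>A coefficient \<open>t n \<ge> s\<close> is at most twice that of the other part, to which \<open>L2\<close> applies.\<close>
    have level: "(\<Sum>n. ennreal ((t n)\<^sup>2) * indicator {0..t n} s)
        \<le> ennreal (4 * K) * (\<integral>\<^sup>+x. ennreal ((norm (f x))\<^sup>2) * indicator {0..\<beta> x} s \<partial>M)"
      if s: "s > 0" for s
    proof -
      define c where "c n = norm (\<integral>x. (f x * indicator {0..\<beta> x} s) * cnj (e n x) \<partial>M)" for n
      have "ennreal ((t n)\<^sup>2) * indicator {0..t n} s \<le> 4 * ennreal ((c n)\<^sup>2)" for n
      proof (cases "s \<le> t n")
        case True
        then have "t n \<le> 2 * c n" using truncate[OF s, of n] by (simp add: c_def)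
        then have "(t n)\<^sup>2 \<le> (2 * c n)\<^sup>2" by (intro power_mono) (auto simp: t_def)
        then have "ennreal ((t n)\<^sup>2) \<le> ennreal (4 * (c n)\<^sup>2)"
          by (intro ennreal_leI) (simp add: power_mult_distrib)
        then show ?thesis using True s by (simp add: ennreal_mult)
      qed simp
      then have "(\<Sum>n. ennreal ((t n)\<^sup>2) * indicator {0..t n} s) \<le> (\<Sum>n. 4 * ennreal ((c n)\<^sup>2))"
        by (intro suminf_le) auto
      also have "\<dots> = 4 * (\<Sum>n. ennreal ((c n)\<^sup>2))" by simp
      also have "\<dots> \<le> 4 * (ennreal K * (\<integral>\<^sup>+x. ennreal ((norm (f x * indicator {0..\<beta> x} s))\<^sup>2) \<partial>M))"
        unfolding c_def by (intro mult_left_mono L2) auto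
      also have "(\<integral>\<^sup>+x. ennreal ((norm (f x * indicator {0..\<beta> x} s))\<^sup>2) \<partial>M)
          = (\<integral>\<^sup>+x. ennreal ((norm (f x))\<^sup>2) * indicator {0..\<beta> x} s \<partial>M)"
        by (intro nn_integral_cong) (auto simp: indicator_def)
      finally show ?thesis using K by (simp add: ennreal_mult mult.assoc)
    qed
    have "(\<Sum>n. ennreal (t n powr q)) = (\<Sum>n. \<integral>\<^sup>+s. W s * indicator {0..t n} s * ennreal ((t n)\<^sup>2) \<partial>lborel)"
    proof (rule suminf_cong)
      fix n
      have t0: "t n \<ge> 0" by (simp add: t_def)
      have "t n powr q = t n powr (q - 2) * (t n)\<^sup>2"
        using t0 by (cases "t n = 0") (simp_all add: powr_diff)
      then show "ennreal (t n powr q) = (\<integral>\<^sup>+s. W s * indicator {0..t n} s * ennreal ((t n)\<^sup>2) \<partial>lborel)"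
        using t0 by (simp add: nn_integral_multc W ennreal_mult)
    qed
    also have "\<dots> = (\<integral>\<^sup>+s. (\<Sum>n. W s * indicator {0..t n} s * ennreal ((t n)\<^sup>2)) \<partial>lborel)"
      by (rule nn_integral_suminf[symmetric]) measurable
    also have "\<dots> = (\<integral>\<^sup>+s. W s * (\<Sum>n. ennreal ((t n)\<^sup>2) * indicator {0..t n} s) \<partial>lborel)"
      by (simp add: mult_ac flip: ennreal_suminf_cmult)
    also have "\<dots> \<le> (\<integral>\<^sup>+s. W s * (ennreal (4 * K) * (\<integral>\<^sup>+x. ennreal ((norm (f x))\<^sup>2) * indicator {0..\<beta> x} s \<partial>M)) \<partial>lborel)"
    proof (intro nn_integral_mono)
      fix s :: real
      consider "s < 0" | "s = 0" | "s > 0" by linarith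
      then show "W s * (\<Sum>n. ennreal ((t n)\<^sup>2) * indicator {0..t n} s)
        \<le> W s * (ennreal (4 * K) * (\<integral>\<^sup>+x. ennreal ((norm (f x))\<^sup>2) * indicator {0..\<beta> x} s \<partial>M))"
        by cases (auto simp: W_def intro!: mult_left_mono level)
    qed
    also have "\<dots> = ennreal (4 * K) * (\<integral>\<^sup>+s. \<integral>\<^sup>+x. W s * (ennreal ((norm (f x))\<^sup>2) * indicator {0..\<beta> x} s) \<partial>M \<partial>lborel)"
      by (simp add: nn_integral_cmult mult.left_commute[of _ "ennreal (4 * K)"])
    also have "(\<integral>\<^sup>+s. \<integral>\<^sup>+x. W s * (ennreal ((norm (f x))\<^sup>2) * indicator {0..\<beta> x} s) \<partial>M \<partial>lborel)
        = (\<integral>\<^sup>+x. \<integral>\<^sup>+s. W s * (ennreal ((norm (f x))\<^sup>2) * indicator {0..\<beta> x} s) \<partial>lborel \<partial>M)"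
      by (rule Fubini') measurable
    also have "\<dots> = (\<integral>\<^sup>+x. ennreal ((2 * A) powr (q - 2)) * ennreal (norm (f x) powr p) \<partial>M)"
    proof (intro nn_integral_cong)
      fix x
      \<comment> \<open>This identity of exponents is where the conjugacy of \<open>p\<close> and \<open>q\<close> is used.\<close>
      have pq: "2 + (1 - p) * (q - 2) = p" using p by (simp add: q field_simps)
      have "(norm (f x))\<^sup>2 * \<beta> x powr (q - 2) = (2 * A) powr (q - 2) * norm (f x) powr p"
      proof (cases "f x = 0")
        case False
        then have "(norm (f x))\<^sup>2 * norm (f x) powr ((1 - p) * (q - 2)) = norm (f x) powr (2 + (1 - p) * (q - 2))"
          by (simp add: powr_add)
        then have "(norm (f x))\<^sup>2 * norm (f x) powr ((1 - p) * (q - 2)) = norm (f x) powr p"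
          by (simp only: pq)
        then show ?thesis using A by (simp add: \<beta>_def powr_mult powr_powr)
      qed simp
      moreover have "(\<integral>\<^sup>+s. W s * (ennreal ((norm (f x))\<^sup>2) * indicator {0..\<beta> x} s) \<partial>lborel)
          = ennreal ((norm (f x))\<^sup>2) * (\<integral>\<^sup>+s. W s * indicator {0..\<beta> x} s \<partial>lborel)"
        by (subst nn_integral_cmult[symmetric]) (auto simp: mult_ac)
      ultimately show "(\<integral>\<^sup>+s. W s * (ennreal ((norm (f x))\<^sup>2) * indicator {0..\<beta> x} s) \<partial>lborel)
          = ennreal ((2 * A) powr (q - 2)) * ennreal (norm (f x) powr p)"
        by (simp add: W \<beta>0 flip: ennreal_mult)
    qed
    also have "\<dots> = ennreal ((2 * A) powr (q - 2)) * ennreal A"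
      by (simp add: nn_integral_cmult nn_integral_eq_integral[OF fp] A_def)
    also have "ennreal (4 * K) * (ennreal ((2 * A) powr (q - 2)) * ennreal A)
        = ennreal (2 powr q * K * A powr (q - 1))"
    proof -
      have "A powr (q - 1) = A powr (q - 2) * A"
        using A powr_add[of A "q - 2" 1] by simp
      moreover have "2 powr q = 4 * 2 powr (q - 2)" by (simp add: powr_diff)
      ultimately have "4 * K * ((2 * A) powr (q - 2) * A) = 2 powr q * K * A powr (q - 1)"
        using A by (simp add: powr_mult)
      then show ?thesis using A K by (simp flip: ennreal_mult)
    qed
    finally show ?thesis by (simp add: t_def A_def)
  qed
qed

section \<open>Fourier transforms and counting measures\<close>

lemma fourier_eq_coefficient: "fourier M f t = (\<integral>x. f x * cnj (exp_char t x) \<partial>M)"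
  by (simp add: fourier_def exp_char_def exp_cnj)

text \<open>The exponentials have modulus one, so on a probability space their \<open>L\<^sup>p\<close> norm is \<open>1\<close> and
  the powers of their modulus disappear.\<close>

lemma semi_inner_exp_char:
  assumes "prob_space M"
  shows "semi_inner p M f (exp_char t) = fourier M f t"
proof -
  interpret prob_space M by fact
  have "sgn (exp_char t x) = exp_char t x" for x
    by (simp add: sgn_div_norm)
  then show ?thesis
    by (simp add: semi_inner_def Lp_norm_def fourier_eq_coefficient prob_space)
qed

lemma fourier_measurable:
  fixes M :: "(real ^ 'd) measure"
  assumes "finite_measure M" and [measurable_cong]: "sets M = sets borel"
    and [measurable]: "f \<in> borel_measurable M"
  shows "fourier M f \<in> borel_measurable borel"
proof -
  interpret finite_measure M by fact
  show ?thesis unfolding fourier_def by measurable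
qed

definition point_counting_measure :: "(nat \<Rightarrow> real ^ 'd) \<Rightarrow> (real ^ 'd) measure" where
  "point_counting_measure l = distr (count_space UNIV) borel l"

lemma sets_point_counting_measure [simp, measurable_cong]:
  "sets (point_counting_measure l) = sets borel"
  by (simp add: point_counting_measure_def)

lemma emeasure_point_counting_measure:
  "A \<in> sets borel \<Longrightarrow> emeasure (point_counting_measure l) A = (\<Sum>n. indicator A (l n))"
  by (simp add: point_counting_measure_def nn_integral_distr flip: nn_integral_indicator nn_integral_count_space_nat)

lemma nn_integral_point_counting_measure:
  "g \<in> borel_measurable borel \<Longrightarrow> (\<integral>\<^sup>+t. g t \<partial>point_counting_measure l) = (\<Sum>n. g (l n))"
  by (simp add: point_counting_measure_def nn_integral_distr nn_integral_count_space_nat)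

lemma emeasure_point_counting_measure_UNIV: "emeasure (point_counting_measure l) UNIV = \<infinity>"
  by (simp add: point_counting_measure_def emeasure_distr)

lemma discrete_point_counting_measure:
  fixes l :: "nat \<Rightarrow> real ^ 'd"
  assumes "inj l"
  shows "discrete_measure (point_counting_measure l)"
  unfolding discrete_measure_def
proof (intro conjI exI[of _ "range l"] exI[of _ "\<lambda>_. 1"] ballI)
  fix A :: "(real ^ 'd) set" assume A: "A \<in> sets borel"
  have "(\<lambda>n. indicator A (l n) :: ennreal) summable_on UNIV"
    by (rule nonneg_summable_on_complete) simp
  then have "((\<lambda>n. indicator A (l n) :: ennreal) has_sum (\<Sum>\<^sub>\<infinity>n. indicator A (l n))) UNIV"
    by (rule has_sum_infsum)
  then have "(\<Sum>\<^sub>\<infinity>n. indicator A (l n) :: ennreal) = (\<Sum>n. indicator A (l n))"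
    using sums_unique[OF has_sum_imp_sums] by blast
  then show "emeasure (point_counting_measure l) A
      = (\<Sum>\<^sub>\<infinity>t\<in>range l. ennreal 1 * emeasure (return borel t) A)"
    using A assms by (simp add: infsum_reindex o_def emeasure_point_counting_measure)
qed auto

section \<open>Existence of Bessel measures\<close>

lemma conjugate_exponent_cases:
  assumes "1 \<le> p" "1 / ennreal p + 1 / q = 1"
  obtains "p = 1" "q = \<infinity>" | "1 < p" "q = ennreal (p / (p - 1))"
proof (cases q)
  case (real r)
  have "r \<noteq> 0" using real assms(2) by auto
  then have r: "r > 0" using real by simp
  have "ennreal (1 / p + 1 / r) = ennreal 1"
    using assms(2) r \<open>1 \<le> p\<close> unfolding real by (simp add: divide_ennreal flip: ennreal_1 ennreal_plus del: ennreal_1)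
  then have eq: "1 / p + 1 / r = 1" using r \<open>1 \<le> p\<close> by (subst (asm) ennreal_inj) auto
  then have "p \<noteq> 1" using r by auto
  then have "p > 1" using assms by simp
  moreover from this have "r = p / (p - 1)" using eq r by (simp add: field_simps)
  ultimately show ?thesis using that(2) real by simp
next
  case top
  then have "ennreal (1 / p) = ennreal 1"
    using assms by (simp add: divide_ennreal flip: ennreal_1 del: ennreal_1)
  then have "p = 1" using assms by (subst (asm) ennreal_inj) auto
  then show ?thesis using that(1) top by simp
qed

text \<open>The counting measure on almost orthogonal frequencies serves for all \<open>p\<close> at once. The case
  \<open>p = 1\<close> is the bound of a Fourier transform by the \<open>L\<^sup>1\<close> norm, \<open>p = 2\<close> is the Bessel
  inequality, and the cases between follow by interpolation, where \<open>r - 1 = r / p\<close> for the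
  conjugate exponent \<open>r\<close> gives the power of the norm.\<close>

lemma exists_infinite_discrete_Bessel_measure:
  fixes M :: "(real ^ 'd) measure"
  assumes M: "prob_space M" "sets M = sets borel"
    and hyperplane: "\<And>a. AE x in M. u \<bullet> x \<noteq> a"
    and p: "1 \<le> p" "p \<le> 2" and conj: "1 / ennreal p + 1 / q = 1"
  shows "\<exists>\<nu>. discrete_measure \<nu> \<and> emeasure \<nu> UNIV = \<infinity> \<and> bessel_measure p q M \<nu>"
proof -
  interpret prob_space M by fact
  note [measurable_cong] = M(2)
  obtain l :: "nat \<Rightarrow> real ^ 'd" where "inj l"
    and row: "\<And>N n. (\<Sum>m<N. norm (\<integral>x. exp_char (l m) x * cnj (exp_char (l n) x) \<partial>M)) \<le> 3"
    using exists_almost_orthogonal_sequence[OF M hyperplane] by blast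
  have L2: "(\<Sum>n. ennreal ((norm (\<integral>x. g x * cnj (exp_char (l n) x) \<partial>M))\<^sup>2))
      \<le> ennreal 3 * (\<integral>\<^sup>+x. ennreal ((norm (g x))\<^sup>2) \<partial>M)" if "g \<in> borel_measurable M" for g
    by (rule Bessel_inequality_of_Gram_row_sums)
       (use that row finite_measure_axioms in auto)
  have "bessel_measure p q M (point_counting_measure l)"
    using p(1) conj
  proof (cases rule: conjugate_exponent_cases)
    case 1
    have "esssup (point_counting_measure l) (\<lambda>t. ennreal (norm (fourier M f t))) \<le> ennreal (1 * Lp_norm p M f)"
      if f: "f \<in> Lp_space p M" for f
    proof (rule esssup_I)
      have [measurable]: "f \<in> borel_measurable M" using f by (simp add: Lp_space_def)
      have [measurable]: "fourier M f \<in> borel_measurable borel"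
        by (intro fourier_measurable M finite_measure_axioms) measurable
      show "(\<lambda>t. ennreal (norm (fourier M f t))) \<in> borel_measurable (point_counting_measure l)"
        by measurable
      have "norm (fourier M f t) \<le> (\<integral>x. norm (f x) \<partial>M)" for t
        unfolding fourier_eq_coefficient
        by (rule order_trans[OF integral_norm_bound]) (simp add: norm_mult)
      then show "AE t in point_counting_measure l. ennreal (norm (fourier M f t)) \<le> ennreal (1 * Lp_norm p M f)"
        using 1 by (intro AE_I2 ennreal_leI) (simp add: Lp_norm_def)
    qed
    then show ?thesis
      unfolding bessel_measure_def using 1 by (intro conjI exI[of _ 1]) auto
  next
    case 2
    define r where "r = p / (p - 1)"
    have r: "r > 1" "q = ennreal r" "q \<noteq> \<infinity>" "enn2real q = r"
      using 2 by (simp_all add: r_def)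
    have "(\<integral>\<^sup>+t. ennreal (norm (semi_inner p M f (exp_char t)) powr r) \<partial>point_counting_measure l)
        \<le> ennreal (2 powr r * 3 * Lp_norm p M f powr r)" if f: "f \<in> Lp_space p M" for f
    proof -
      have f_meas [measurable]: "f \<in> borel_measurable M" and fp: "integrable M (\<lambda>x. norm (f x) powr p)"
        using f by (simp_all add: Lp_space_def)
      have [measurable]: "fourier M f \<in> borel_measurable borel"
        by (intro fourier_measurable M finite_measure_axioms) measurable
      have norm_eq: "Lp_norm p M f powr r = (\<integral>x. norm (f x) powr p \<partial>M) powr (r - 1)"
      proof -
        have "1 / p * r = r - 1" using 2 by (simp add: r_def field_simps)
        then show ?thesis by (simp add: Lp_norm_def powr_powr)
      qed
      have "(\<integral>\<^sup>+t. ennreal (norm (semi_inner p M f (exp_char t)) powr r) \<partial>point_counting_measure l)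
          = (\<Sum>n. ennreal (norm (\<integral>x. f x * cnj (exp_char (l n) x) \<partial>M) powr r))"
        by (subst nn_integral_point_counting_measure) (simp_all add: semi_inner_exp_char M fourier_eq_coefficient[symmetric])
      also have "\<dots> \<le> ennreal (2 powr r * 3 * (\<integral>x. norm (f x) powr p \<partial>M) powr (r - 1))"
      proof (cases "p = 2")
        case True
        then have "r = 2" by (simp add: r_def)
        have "(\<Sum>n. ennreal ((norm (\<integral>x. f x * cnj (exp_char (l n) x) \<partial>M))\<^sup>2))
            \<le> ennreal 3 * (\<integral>\<^sup>+x. ennreal (norm (f x) powr p) \<partial>M)"
          using L2[OF f_meas] by (simp add: \<open>p = 2\<close>)
        also have "\<dots> = ennreal (3 * (\<integral>x. norm (f x) powr p \<partial>M))"
          by (simp add: nn_integral_eq_integral[OF fp] ennreal_mult)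
        also have "\<dots> \<le> ennreal (2 powr r * 3 * (\<integral>x. norm (f x) powr p \<partial>M) powr (r - 1))"
          using \<open>r = 2\<close> by (intro ennreal_leI) (simp add: abs_of_nonneg)
        finally show ?thesis using \<open>r = 2\<close> by simp
      next
        case False
        show ?thesis
          by (rule Lq_bound_of_L2_bound[OF finite_measure_axioms _ _ _ L2 _ _ r_def])
             (use False p 2 fp integrable_of_Lp_space[OF finite_measure_axioms p(1) f] in auto)
      qed
      finally show ?thesis unfolding norm_eq .
    qed
    then show ?thesis
      unfolding bessel_measure_def using r by (intro conjI exI[of _ "2 powr r * 3"]) auto
  qed
  then show ?thesis
    using discrete_point_counting_measure[OF \<open>inj l\<close>] emeasure_point_counting_measure_UNIV by blast
qed

lemma normalized_lebesgue_prob_space: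
  fixes S :: "(real ^ 'd) set"
  assumes S: "S \<in> sets lebesgue" "0 < emeasure lebesgue S" "emeasure lebesgue S < \<infinity>"
  shows "prob_space (normalized_lebesgue S)"
proof
  note [measurable] = S(1)
  define c where "c = emeasure lebesgue S"
  have [measurable]: "(\<lambda>x. x) \<in> lebesgue \<rightarrow>\<^sub>M (borel :: (real ^ 'd) measure)"
    by (simp add: measurable_completion)
  have "emeasure (normalized_lebesgue S) (space (normalized_lebesgue S))
      = (\<integral>\<^sup>+x. indicator S x / c \<partial>lebesgue)"
    unfolding normalized_lebesgue_def c_def[symmetric]
    by (subst emeasure_distr) (auto simp: emeasure_density)
  also have "\<dots> = emeasure lebesgue S / c"
    by (subst nn_integral_divide) auto
  also have "\<dots> = 1" using S by (simp add: c_def ennreal_divide_self)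
  finally show "emeasure (normalized_lebesgue S) (space (normalized_lebesgue S)) = 1" .
qed

lemma normalized_lebesgue_hyperplane:
  fixes S :: "(real ^ 'd) set"
  assumes S [measurable]: "S \<in> sets lebesgue" and u: "u \<noteq> 0"
  shows "AE x in normalized_lebesgue S. u \<bullet> x \<noteq> a"
proof -
  have [measurable]: "(\<lambda>x. x) \<in> lebesgue \<rightarrow>\<^sub>M (borel :: (real ^ 'd) measure)"
    by (simp add: measurable_completion)
  have "{x. u \<bullet> x = a} \<in> null_sets lebesgue"
    using negligible_hyperplane[of u a] u by (simp add: negligible_iff_null_sets)
  then have "AE x in lebesgue. u \<bullet> x \<noteq> a" by (rule AE_I') auto
  then show ?thesis
    unfolding normalized_lebesgue_def
    by (subst AE_distr_iff) (auto simp: AE_density)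
qed

theorem theorem3p16:
  fixes S :: "(real ^ 'd) set" and p :: real and q :: ennreal
  assumes "S \<in> sets lebesgue"
    and "0 < emeasure lebesgue S" and "emeasure lebesgue S < \<infinity>"
    and "1 \<le> p" and "p \<le> 2"
    and "1 / ennreal p + 1 / q = 1"
  shows "\<exists>\<nu> :: (real ^ 'd) measure.
           discrete_measure \<nu> \<and> emeasure \<nu> UNIV = \<infinity> \<and>
           bessel_measure p q (normalized_lebesgue S) \<nu>"
proof (rule exists_infinite_discrete_Bessel_measure)
  show "prob_space (normalized_lebesgue S)"
    using assms by (intro normalized_lebesgue_prob_space)
  show "sets (normalized_lebesgue S) = sets borel"
    by (simp add: normalized_lebesgue_def)
  \<comment> \<open>Any nonzero vector would do; this one is a vector of the standard basis.\<close>
  show "AE x in normalized_lebesgue S. axis (undefined :: 'd) (1 :: real) \<bullet> x \<noteq> a" for a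
    using assms(1) by (rule normalized_lebesgue_hyperplane) (simp add: axis_eq_0_iff)
qed (use assms in auto)

end
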